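(* Let $2<q<\infty$. Then for every $1<p<\infty$ the operators $\mathcal{V}_{q,J}(A)$, $J$ ranging over the finite subsets of $(0,\infty)$, are not uniformly bounded on $L^p(\mathbb{R};L^\infty(\mathbb{R}))$; that is, there is no constant $K<\infty$ such that $$\|\mathcal{V}_{q,J}(A)f\|_{L^p(\mathbb{R};L^\infty(\mathbb{R}))}\le K\,\|f\|_{L^p(\mathbb{R};L^\infty(\mathbb{R}))}$$ for all finite $J\subset(0,\infty)$ and all $f\in L^p(\mathbb{R};L^\infty(\mathbb{R}))$.
   Context: Let $X$ be a Banach lattice (here $X=L^\infty(\mathbb{R})$), and let $L^p(\mathbb{R};X)$ be the usual Lebesgue–Bochner space of $X$-valued functions with norm $\|f\|_{L^p(\mathbb{R};X)}=\big(\int_{\mathbb{R}}\|f(x)\|_X^p\,dx\big)^{1/p}$. For a locally integrable $f:\mathbb{R}\to X$ and $t>0$, define $$A_tf(x)=\frac1t\int_{-t}^{t}f(x-y)\,dy .$$ For a finite set $J\subset(0,\infty)$ and $2<q<\infty$, define $$\mathcal{V}_{q,J}(A)f(x)=\sup_{\{t_i\}\subset J}\Big(\sum_i|A_{t_i}f(x)-A_{t_{i+1}}f(x)|^q\Big)^{1/q}\in X,$$ where the supremum runs over all (finite) decreasing sequences $\{t_i\}$ in $J$, and the absolute value, the $q$-th power sum and the supremum are taken in the lattice $X$ (for $X$ a space of measurable functions on $\Omega$: pointwise a.e. in $\omega\in\Omega$). *)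

theory Defs
  imports
    "HOL-Analysis.Analysis"
    "HOL-Probability.Essential_Supremum"
    "HOL-Library.Lattice_Algebras"
begin

section \<open>The Banach lattice $L^\infty(\mathbb{R})$\<close>

definition ess_bounded :: "(real \<Rightarrow> real) \<Rightarrow> bool" where
  "ess_bounded u \<longleftrightarrow> u \<in> borel_measurable lebesgue \<and> (\<exists>C. AE w in lebesgue. \<bar>u w\<bar> \<le> C)"

definition linfty_rel :: "(real \<Rightarrow> real) \<Rightarrow> (real \<Rightarrow> real) \<Rightarrow> bool" where
  "linfty_rel u v \<longleftrightarrow> ess_bounded u \<and> ess_bounded v \<and> (AE w in lebesgue. u w = v w)"

lemma ess_bounded_const: "ess_bounded (\<lambda>w. c)"
  unfolding ess_bounded_def by (auto intro!: exI[of _ "\<bar>c\<bar>"])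

lemma ess_bounded_binop:
  assumes "ess_bounded u" "ess_bounded v"
    and "case_prod h \<in> borel_measurable (borel \<Otimes>\<^sub>M borel)"
    and h: "\<And>a b C D. \<bar>a\<bar> \<le> C \<Longrightarrow> \<bar>b\<bar> \<le> D \<Longrightarrow> \<bar>h a b\<bar> \<le> k C D"
  shows "ess_bounded (\<lambda>w. h (u w) (v w))"
proof -
  note [measurable] = assms(3)
  obtain C D where "AE w in lebesgue. \<bar>u w\<bar> \<le> C" "AE w in lebesgue. \<bar>v w\<bar> \<le> D"
    and [measurable]: "u \<in> borel_measurable lebesgue" "v \<in> borel_measurable lebesgue"
    using assms(1,2) by (auto simp: ess_bounded_def)
  then have "AE w in lebesgue. \<bar>h (u w) (v w)\<bar> \<le> k C D"
    by (auto elim!: eventually_elim2 intro: h)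
  moreover have "(\<lambda>w. case_prod h (u w, v w)) \<in> borel_measurable lebesgue"
    by measurable
  ultimately show ?thesis
    by (auto simp: ess_bounded_def)
qed

lemma linfty_rel_binop:
  assumes "linfty_rel u u'" "linfty_rel v v'"
    and "case_prod h \<in> borel_measurable (borel \<Otimes>\<^sub>M borel)"
    and "\<And>a b C D. \<bar>a\<bar> \<le> C \<Longrightarrow> \<bar>b\<bar> \<le> D \<Longrightarrow> \<bar>h a b\<bar> \<le> k C D"
  shows "linfty_rel (\<lambda>w. h (u w) (v w)) (\<lambda>w. h (u' w) (v' w))"
  using assms(1,2) ess_bounded_binop[OF _ _ assms(3,4)]
  by (auto simp: linfty_rel_def)

lemma linfty_rel_unop:
  assumes "linfty_rel u u'"
    and [measurable]: "h \<in> borel_measurable borel"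
    and h: "\<And>a C. \<bar>a\<bar> \<le> C \<Longrightarrow> \<bar>h a\<bar> \<le> k C"
  shows "linfty_rel (\<lambda>w. h (u w)) (\<lambda>w. h (u' w))"
  by (rule linfty_rel_binop[OF assms(1) assms(1), of "\<lambda>a b. h a" "\<lambda>C D. k C"])
     (measurable, use h in auto)

lemma ess_bounded_arith:
  assumes "ess_bounded u" "ess_bounded v"
  shows "ess_bounded (\<lambda>w. u w + v w)" "ess_bounded (\<lambda>w. u w - v w)"
    "ess_bounded (\<lambda>w. - u w)" "ess_bounded (\<lambda>w. c * u w)"
proof -
  show "ess_bounded (\<lambda>w. u w + v w)"
    by (rule ess_bounded_binop[OF assms, where k="(+)"]) auto
  show "ess_bounded (\<lambda>w. u w - v w)"
    by (rule ess_bounded_binop[OF assms, where k="(+)"]) auto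
  show "ess_bounded (\<lambda>w. - u w)"
    by (rule ess_bounded_binop[OF assms, where k="\<lambda>C D. C" and h="\<lambda>a b. - a"]) auto
  show "ess_bounded (\<lambda>w. c * u w)"
    by (rule ess_bounded_binop[OF assms, where k="\<lambda>C D. \<bar>c\<bar> * C" and h="\<lambda>a b. c * a"])
       (auto simp: abs_mult intro!: mult_left_mono)
qed

quotient_type linfty = "real \<Rightarrow> real" / partial: linfty_rel
  morphisms rep_of_linfty linfty_of
proof (rule part_equivpI)
  show "\<exists>u. linfty_rel u u"
    using ess_bounded_const[of 0] by (auto simp: linfty_rel_def)
  show "symp linfty_rel"
    by (auto simp: symp_def linfty_rel_def)
  show "transp linfty_rel"
    by (auto simp: transp_def linfty_rel_def)
qed

instantiation linfty :: "{real_vector, lattice, abs}"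
begin

lift_definition zero_linfty :: linfty is "\<lambda>w. 0"
  by (simp add: linfty_rel_def ess_bounded_const)

lift_definition plus_linfty :: "linfty \<Rightarrow> linfty \<Rightarrow> linfty" is "\<lambda>u v w. u w + v w"
  by (rule linfty_rel_binop[where k="(+)"]) (auto intro: abs_triangle_ineq[THEN order_trans])

lift_definition uminus_linfty :: "linfty \<Rightarrow> linfty" is "\<lambda>u w. - u w"
  by (rule linfty_rel_unop[where k="\<lambda>C. C"]) auto

lift_definition minus_linfty :: "linfty \<Rightarrow> linfty \<Rightarrow> linfty" is "\<lambda>u v w. u w - v w"
  by (rule linfty_rel_binop[where k="(+)"]) auto

lift_definition scaleR_linfty :: "real \<Rightarrow> linfty \<Rightarrow> linfty" is "\<lambda>c u w. c * u w"
  subgoal for c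
    by (rule linfty_rel_unop[where k="\<lambda>C. \<bar>c\<bar> * C"]) (auto simp: abs_mult intro!: mult_left_mono)
  done

lift_definition less_eq_linfty :: "linfty \<Rightarrow> linfty \<Rightarrow> bool" is
  "\<lambda>u v. AE w in lebesgue. u w \<le> v w"
proof -
  fix u u' v v'
  assume "linfty_rel u u'" "linfty_rel v v'"
  then have "AE w in lebesgue. u w = u' w" "AE w in lebesgue. v w = v' w"
    by (simp_all add: linfty_rel_def)
  then have "AE w in lebesgue. (u w \<le> v w) = (u' w \<le> v' w)"
    by eventually_elim simp
  then show "(AE w in lebesgue. u w \<le> v w) = (AE w in lebesgue. u' w \<le> v' w)"
    by (rule eventually_subst)
qed

definition less_linfty :: "linfty \<Rightarrow> linfty \<Rightarrow> bool" where
  "less_linfty u v \<longleftrightarrow> u \<le> v \<and> \<not> v \<le> u"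

lift_definition sup_linfty :: "linfty \<Rightarrow> linfty \<Rightarrow> linfty" is "\<lambda>u v w. max (u w) (v w)"
  by (rule linfty_rel_binop[where k="max"]) (auto simp: case_prod_beta)

lift_definition inf_linfty :: "linfty \<Rightarrow> linfty \<Rightarrow> linfty" is "\<lambda>u v w. min (u w) (v w)"
  by (rule linfty_rel_binop[where k="max"]) (auto simp: case_prod_beta)

lift_definition abs_linfty :: "linfty \<Rightarrow> linfty" is "\<lambda>u w. \<bar>u w\<bar>"
  by (rule linfty_rel_unop[where k="\<lambda>C. C"]) auto

instance
proof
  fix u v z :: linfty and a b :: real
  show "u + v + z = u + (v + z)" "u + v = v + u" "0 + u = u" "- u + u = 0" "u - v = u + - v"
    "a *\<^sub>R (u + v) = a *\<^sub>R u + a *\<^sub>R v" "(a + b) *\<^sub>R u = a *\<^sub>R u + b *\<^sub>R u"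
    "a *\<^sub>R b *\<^sub>R u = (a * b) *\<^sub>R u" "1 *\<^sub>R u = u"
    by (transfer, simp only: linfty_rel_def,
        intro conjI ess_bounded_arith ess_bounded_const AE_I2; simp add: algebra_simps)+
  show "(u < v) = (u \<le> v \<and> \<not> v \<le> u)" by (rule less_linfty_def)
  show "u \<le> u" by transfer simp
  show "u \<le> v \<Longrightarrow> v \<le> z \<Longrightarrow> u \<le> z"
    by transfer (auto elim: eventually_elim2)
  show "u \<le> v \<Longrightarrow> v \<le> u \<Longrightarrow> u = v"
    by transfer (auto simp: linfty_rel_def elim: eventually_elim2)
  show "inf u v \<le> u" "inf u v \<le> v" "u \<le> sup u v" "v \<le> sup u v"
    by (transfer; simp)+
  show "u \<le> v \<Longrightarrow> u \<le> z \<Longrightarrow> u \<le> inf v z" "v \<le> u \<Longrightarrow> z \<le> u \<Longrightarrow> sup v z \<le> u"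
    by (transfer; auto elim: eventually_elim2)+
qed

end

instance linfty :: ordered_real_vector
proof
  fix u v z :: linfty and a b :: real
  show "u \<le> v \<Longrightarrow> z + u \<le> z + v" by transfer simp
  show "u \<le> v \<Longrightarrow> 0 \<le> a \<Longrightarrow> a *\<^sub>R u \<le> a *\<^sub>R v"
    by transfer (auto elim!: eventually_mono intro: mult_left_mono)
  show "a \<le> b \<Longrightarrow> 0 \<le> u \<Longrightarrow> a *\<^sub>R u \<le> b *\<^sub>R u"
    by transfer (auto elim!: eventually_mono intro: mult_right_mono)
qed

instance linfty :: lattice_ab_group_add_abs
proof
  fix u :: linfty
  show "\<bar>u\<bar> = sup u (- u)"
  proof transfer
    fix u assume u: "linfty_rel u u"
    have "(\<lambda>w. max (u w) (- u w)) = (\<lambda>w. \<bar>u w\<bar>)" by (auto simp: max_def)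
    moreover have "linfty_rel (\<lambda>w. \<bar>u w\<bar>) (\<lambda>w. \<bar>u w\<bar>)"
      by (rule linfty_rel_unop[OF u, where k="\<lambda>C. C"]) auto
    ultimately show "linfty_rel (\<lambda>w. \<bar>u w\<bar>) (\<lambda>w. max (u w) (- u w))" by simp
  qed
qed

instantiation linfty :: real_normed_vector
begin

lift_definition norm_linfty :: "linfty \<Rightarrow> real" is
  "\<lambda>u. real_of_ereal (esssup lebesgue (\<lambda>w. ereal \<bar>u w\<bar>))"
  by (rule arg_cong[where f=real_of_ereal], rule esssup_AE_cong)
     (auto simp: linfty_rel_def ess_bounded_def)

definition dist_linfty :: "linfty \<Rightarrow> linfty \<Rightarrow> real" where
  "dist_linfty u v = norm (u - v)"

definition sgn_linfty :: "linfty \<Rightarrow> linfty" where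
  "sgn_linfty u = inverse (norm u) *\<^sub>R u"

definition uniformity_linfty :: "(linfty \<times> linfty) filter" where
  "uniformity_linfty = (INF e\<in>{0<..}. principal {(u, v). dist u v < e})"

definition open_linfty :: "linfty set \<Rightarrow> bool" where
  "open_linfty U = (\<forall>u\<in>U. eventually (\<lambda>(u', v). u' = u \<longrightarrow> v \<in> U) uniformity)"

lemma norm_linfty_rep:
  assumes "ess_bounded u"
  defines "N \<equiv> real_of_ereal (esssup lebesgue (\<lambda>w. ereal \<bar>u w\<bar>))"
  shows "AE w in lebesgue. \<bar>u w\<bar> \<le> N" and "(AE w in lebesgue. \<bar>u w\<bar> \<le> C) \<Longrightarrow> N \<le> C"
    and "0 \<le> N"
proof -
  let ?E = "esssup lebesgue (\<lambda>w. ereal \<bar>u w\<bar>)"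
  have [measurable]: "u \<in> borel_measurable lebesgue"
    using assms(1) by (simp add: ess_bounded_def)
  have "esssup lebesgue (\<lambda>w::real. 0::ereal) = 0"
    by (rule esssup_const) simp
  moreover have "esssup lebesgue (\<lambda>w::real. 0::ereal) \<le> ?E"
    by (rule esssup_mono) auto
  ultimately have E0: "0 \<le> ?E" by simp
  have le: "?E \<le> ereal C" if "AE w in lebesgue. \<bar>u w\<bar> \<le> C" for C
    by (rule esssup_I) (use that in auto)
  obtain C0 where "AE w in lebesgue. \<bar>u w\<bar> \<le> C0"
    using assms(1) by (auto simp: ess_bounded_def)
  then have E: "?E = ereal N"
    using le[of C0] E0 unfolding N_def by (cases ?E) auto
  show "AE w in lebesgue. \<bar>u w\<bar> \<le> N"
    using esssup_AE[of "\<lambda>w. ereal \<bar>u w\<bar>" lebesgue] unfolding E by simp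
  show "(AE w in lebesgue. \<bar>u w\<bar> \<le> C) \<Longrightarrow> N \<le> C"
    using le[of C] unfolding E by simp
  show "0 \<le> N" using E0 unfolding E by simp
qed

instance
proof
  fix u v :: linfty and a :: real
  show "dist u v = norm (u - v)" by (rule dist_linfty_def)
  show "sgn u = u /\<^sub>R norm u" by (rule sgn_linfty_def)
  show "(uniformity :: (linfty \<times> linfty) filter) = (INF e\<in>{0<..}. principal {(u, v). dist u v < e})"
    by (rule uniformity_linfty_def)
  show "open U = (\<forall>u\<in>U. \<forall>\<^sub>F (u', v) in uniformity. u' = u \<longrightarrow> v \<in> U)" for U :: "linfty set"
    by (rule open_linfty_def)
  show "(norm u = 0) = (u = 0)"
  proof transfer
    fix u assume "linfty_rel u u"
    then have u: "ess_bounded u" by (simp add: linfty_rel_def)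
    let ?N = "real_of_ereal (esssup lebesgue (\<lambda>w. ereal \<bar>u w\<bar>))"
    show "(?N = 0) = linfty_rel u (\<lambda>w. 0)"
    proof
      assume "?N = 0"
      then show "linfty_rel u (\<lambda>w. 0)"
        using norm_linfty_rep(1)[OF u] u by (simp add: linfty_rel_def ess_bounded_const)
    next
      assume "linfty_rel u (\<lambda>w. 0)"
      then have "AE w in lebesgue. \<bar>u w\<bar> \<le> 0" by (simp add: linfty_rel_def)
      show "?N = 0"
        using norm_linfty_rep(2)[OF u \<open>AE w in lebesgue. \<bar>u w\<bar> \<le> 0\<close>] norm_linfty_rep(3)[OF u]
        by (rule antisym)
    qed
  qed
  show "norm (u + v) \<le> norm u + norm v"
  proof transfer
    fix u v assume "linfty_rel u u" "linfty_rel v v"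
    then have u: "ess_bounded u" and v: "ess_bounded v" by (simp_all add: linfty_rel_def)
    show "real_of_ereal (esssup lebesgue (\<lambda>w. ereal \<bar>u w + v w\<bar>))
      \<le> real_of_ereal (esssup lebesgue (\<lambda>w. ereal \<bar>u w\<bar>)) + real_of_ereal (esssup lebesgue (\<lambda>w. ereal \<bar>v w\<bar>))"
    proof (rule norm_linfty_rep(2)[OF ess_bounded_arith(1)[OF u v]])
      show "AE w in lebesgue. \<bar>u w + v w\<bar> \<le> real_of_ereal (esssup lebesgue (\<lambda>w. ereal \<bar>u w\<bar>))
          + real_of_ereal (esssup lebesgue (\<lambda>w. ereal \<bar>v w\<bar>))"
        using norm_linfty_rep(1)[OF u] norm_linfty_rep(1)[OF v] by eventually_elim linarith
    qed
  qed
  have le: "norm (a *\<^sub>R u) \<le> \<bar>a\<bar> * norm u" for a and u :: linfty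
  proof (transfer fixing: a)
    fix u assume "linfty_rel u u"
    then have u: "ess_bounded u" by (simp add: linfty_rel_def)
    show "real_of_ereal (esssup lebesgue (\<lambda>w. ereal \<bar>a * u w\<bar>))
      \<le> \<bar>a\<bar> * real_of_ereal (esssup lebesgue (\<lambda>w. ereal \<bar>u w\<bar>))"
    proof (rule norm_linfty_rep(2)[OF ess_bounded_arith(4)[OF u u]])
      show "AE w in lebesgue. \<bar>a * u w\<bar> \<le> \<bar>a\<bar> * real_of_ereal (esssup lebesgue (\<lambda>w. ereal \<bar>u w\<bar>))"
        using norm_linfty_rep(1)[OF u] by eventually_elim (simp add: abs_mult mult_left_mono)
    qed
  qed
  show "norm (a *\<^sub>R u) = \<bar>a\<bar> * norm u"
  proof (cases "a = 0")
    case True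
    moreover have "norm (0 :: linfty) \<le> 0" using le[of 0 0] by simp
    moreover have "0 \<le> norm (0 :: linfty)"
      by transfer (rule norm_linfty_rep(3)[OF ess_bounded_const])
    ultimately show ?thesis by simp
  next
    case False
    have "norm u \<le> inverse \<bar>a\<bar> * norm (a *\<^sub>R u)"
      using le[of "inverse a" "a *\<^sub>R u"] False by simp
    then have "\<bar>a\<bar> * norm u \<le> norm (a *\<^sub>R u)"
      using False by (simp add: field_simps)
    then show ?thesis using le[of a u] by simp
  qed
qed

end

lemma norm_linfty_mono:
  fixes u v :: linfty
  assumes "\<bar>u\<bar> \<le> \<bar>v\<bar>"
  shows "norm u \<le> norm v"
  using assms
proof transfer
  fix u v
  assume "linfty_rel u u" "linfty_rel v v" and le: "AE w in lebesgue. \<bar>u w\<bar> \<le> \<bar>v w\<bar>"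
  then have u: "ess_bounded u" and v: "ess_bounded v" by (simp_all add: linfty_rel_def)
  show "real_of_ereal (esssup lebesgue (\<lambda>w. ereal \<bar>u w\<bar>))
      \<le> real_of_ereal (esssup lebesgue (\<lambda>w. ereal \<bar>v w\<bar>))"
    by (rule norm_linfty_rep(2)[OF u]) (use le norm_linfty_rep(1)[OF v] in eventually_elim, simp)
qed

lemma linfty_of_cases:
  obtains u where "ess_bounded u" "x = linfty_of u"
  by (rule linfty.abs_induct[of "\<lambda>y. y = x \<longrightarrow> thesis" x, THEN mp])
     (auto simp: linfty_rel_def intro: that)

lemma norm_linfty_of_diff:
  assumes u: "ess_bounded u" and v: "ess_bounded v"
  shows "AE w in lebesgue. \<bar>u w - v w\<bar> \<le> norm (linfty_of u - linfty_of v)"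
    and "(AE w in lebesgue. \<bar>u w - v w\<bar> \<le> C) \<Longrightarrow> norm (linfty_of u - linfty_of v) \<le> C"
proof -
  note d = ess_bounded_arith(2)[OF u v]
  have "linfty_rel u u" "linfty_rel v v" "linfty_rel (\<lambda>w. u w - v w) (\<lambda>w. u w - v w)"
    using u v d by (auto simp: linfty_rel_def)
  then have eq: "norm (linfty_of u - linfty_of v)
      = real_of_ereal (esssup lebesgue (\<lambda>w. ereal \<bar>u w - v w\<bar>))"
    by (simp add: minus_linfty.abs_eq norm_linfty.abs_eq)
  show "AE w in lebesgue. \<bar>u w - v w\<bar> \<le> norm (linfty_of u - linfty_of v)"
    unfolding eq by (rule norm_linfty_rep(1)[OF d])
  show "(AE w in lebesgue. \<bar>u w - v w\<bar> \<le> C) \<Longrightarrow> norm (linfty_of u - linfty_of v) \<le> C"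
    unfolding eq by (rule norm_linfty_rep(2)[OF d])
qed

instance linfty :: banach
proof
  fix X :: "nat \<Rightarrow> linfty"
  assume X: "Cauchy X"
  have "\<exists>r. \<forall>n. ess_bounded (r n) \<and> X n = linfty_of (r n)"
    by (rule choice) (meson linfty_of_cases)
  then obtain r where r: "\<And>n. ess_bounded (r n)" and Xr: "X = (\<lambda>n. linfty_of (r n))"
    by auto
  have [measurable]: "r n \<in> borel_measurable lebesgue" for n
    using r by (simp add: ess_bounded_def)
  define L where "L w = lim (\<lambda>n. r n w)" for w
  have [measurable]: "L \<in> borel_measurable lebesgue"
    unfolding L_def by measurable
  have "AE w in lebesgue. \<forall>m n. \<bar>r m w - r n w\<bar> \<le> norm (X m - X n)"
    unfolding AE_all_countable Xr by (intro allI norm_linfty_of_diff(1) r)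
  then have lim: "AE w in lebesgue. (\<lambda>n. r n w) \<longlonglongrightarrow> L w \<and>
      (\<forall>m n. \<bar>r m w - r n w\<bar> \<le> norm (X m - X n))"
  proof eventually_elim
    case (elim w)
    have "Cauchy (\<lambda>n. r n w)"
      unfolding Cauchy_altdef2 dist_real_def
      using X elim unfolding Cauchy_altdef2 dist_norm by (meson le_less_trans)
    then show ?case
      unfolding L_def using elim by (simp add: Cauchy_convergent convergent_LIMSEQ_iff[symmetric])
  qed
  have unif: "\<exists>N. \<forall>n\<ge>N. AE w in lebesgue. \<bar>r n w - L w\<bar> \<le> e" if "0 < e" for e
  proof -
    obtain N where N: "\<And>m n. N \<le> m \<Longrightarrow> N \<le> n \<Longrightarrow> norm (X m - X n) < e"
      using X \<open>0 < e\<close> unfolding Cauchy_def dist_norm by blast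
    have "AE w in lebesgue. \<bar>r n w - L w\<bar> \<le> e" if "N \<le> n" for n
      using lim
    proof eventually_elim
      case (elim w)
      then have "(\<lambda>m. \<bar>r n w - r m w\<bar>) \<longlonglongrightarrow> \<bar>r n w - L w\<bar>"
        by (intro tendsto_intros) auto
      moreover have "\<bar>r n w - r m w\<bar> \<le> e" if "N \<le> m" for m
        using elim N[OF \<open>N \<le> n\<close> that] by (meson less_imp_le order_trans)
      ultimately show ?case
        by (intro LIMSEQ_le_const2) auto
    qed
    then show ?thesis by blast
  qed
  have L: "ess_bounded L"
  proof -
    obtain N where "AE w in lebesgue. \<bar>r N w - L w\<bar> \<le> 1"
      using unif[of 1] by auto
    moreover obtain C where "AE w in lebesgue. \<bar>r N w\<bar> \<le> C"
      using r[of N] by (auto simp: ess_bounded_def)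
    ultimately have "AE w in lebesgue. \<bar>L w\<bar> \<le> C + 1"
      by eventually_elim linarith
    then show ?thesis by (auto simp: ess_bounded_def)
  qed
  have "X \<longlonglongrightarrow> linfty_of L"
  proof (rule metric_LIMSEQ_I)
    fix e :: real assume "0 < e"
    then obtain N where N: "\<And>n. N \<le> n \<Longrightarrow> AE w in lebesgue. \<bar>r n w - L w\<bar> \<le> e / 2"
      using unif[of "e / 2"] by auto
    have "dist (X n) (linfty_of L) < e" if "N \<le> n" for n
      using norm_linfty_of_diff(2)[OF r L N[OF that]] \<open>0 < e\<close> by (simp add: Xr dist_norm)
    then show "\<exists>N. \<forall>n\<ge>N. dist (X n) (linfty_of L) < e" by blast
  qed
  then show "convergent X" by (rule convergentI)
qed

text \<open>The power $|u|^r$ in the lattice, for $r > 0$ (for a negative exponent the pointwise power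
  of a bounded function need not be bounded; such exponents are never used).\<close>

lift_definition linfty_powr :: "linfty \<Rightarrow> real \<Rightarrow> linfty" is
  "\<lambda>u r w. if 0 < r then \<bar>u w\<bar> powr r else 0"
  subgoal for u u' r
    by (cases "0 < r", simp_all add: linfty_rel_def[of "\<lambda>w. 0"] ess_bounded_const)
       (rule linfty_rel_unop[where k="\<lambda>C. C powr r"], auto intro!: powr_mono2)
  done


section \<open>The Bochner integral\<close>

text \<open>The library's Bochner integral is confined to second-countable spaces, and
  $L^\infty(\mathbb{R})$ is not separable. The definitions below are the library's, except that Borel
  measurability is replaced by strong measurability.\<close>

definition strongly_measurable :: "'a measure \<Rightarrow> ('a \<Rightarrow> 'b::real_normed_vector) \<Rightarrow> bool" where
  "strongly_measurable M f \<longleftrightarrow>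
     (\<exists>s. (\<forall>n::nat. simple_function M (s n)) \<and> (AE x in M. (\<lambda>n. s n x) \<longlonglongrightarrow> f x))"

definition has_Bochner_integral ::
  "'a measure \<Rightarrow> ('a \<Rightarrow> 'b::real_normed_vector) \<Rightarrow> 'b \<Rightarrow> bool" where
  "has_Bochner_integral M f I \<longleftrightarrow> strongly_measurable M f \<and>
     (\<exists>s. (\<forall>n::nat. Bochner_Integration.simple_bochner_integrable M (s n)) \<and>
          (\<lambda>n. \<integral>\<^sup>+ x. ennreal (norm (f x - s n x)) \<partial>M) \<longlonglongrightarrow> 0 \<and>
          (\<lambda>n. Bochner_Integration.simple_bochner_integral M (s n)) \<longlonglongrightarrow> I)"

definition Bochner_integral :: "'a measure \<Rightarrow> ('a \<Rightarrow> 'b::real_normed_vector) \<Rightarrow> 'b" where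
  "Bochner_integral M f =
     (if \<exists>I. has_Bochner_integral M f I then THE I. has_Bochner_integral M f I else 0)"

lemma has_Bochner_integral_unique:
  assumes "has_Bochner_integral M f I" "has_Bochner_integral M f I'"
  shows "I = I'"
proof -
  obtain s t
    where s: "\<And>n::nat. Bochner_Integration.simple_bochner_integrable M (s n)"
      and s0: "(\<lambda>n. \<integral>\<^sup>+ x. ennreal (norm (f x - s n x)) \<partial>M) \<longlonglongrightarrow> 0"
      and sI: "(\<lambda>n. Bochner_Integration.simple_bochner_integral M (s n)) \<longlonglongrightarrow> I"
      and t: "\<And>n::nat. Bochner_Integration.simple_bochner_integrable M (t n)"
      and t0: "(\<lambda>n. \<integral>\<^sup>+ x. ennreal (norm (f x - t n x)) \<partial>M) \<longlonglongrightarrow> 0"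
      and tI: "(\<lambda>n. Bochner_Integration.simple_bochner_integral M (t n)) \<longlonglongrightarrow> I'"
    using assms unfolding has_Bochner_integral_def by blast
  obtain a where a: "\<And>n::nat. simple_function M (a n)"
      and af: "AE x in M. (\<lambda>n. a n x) \<longlonglongrightarrow> f x"
    using assms(1) unfolding has_Bochner_integral_def strongly_measurable_def by blast
  let ?S = "\<lambda>n. \<integral>\<^sup>+ x. ennreal (norm (f x - s n x)) \<partial>M"
  let ?T = "\<lambda>n. \<integral>\<^sup>+ x. ennreal (norm (f x - t n x)) \<partial>M"
  have meas: "\<exists>g \<in> borel_measurable M. AE x in M. ennreal (norm (f x - b x)) = g x"
    if b: "simple_function M b" for b
  proof (rule bexI)
    have sf: "simple_function M (\<lambda>x. ennreal (norm (a n x - b x)))" for n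
      by (rule simple_function_compose2[OF a b])
    show "(\<lambda>x. liminf (\<lambda>n. ennreal (norm (a n x - b x)))) \<in> borel_measurable M"
      by (rule borel_measurable_liminf) (rule borel_measurable_simple_function[OF sf])
    show "AE x in M. ennreal (norm (f x - b x)) = liminf (\<lambda>n. ennreal (norm (a n x - b x)))"
      using af
    proof eventually_elim
      case (elim x)
      then have "(\<lambda>n. ennreal (norm (a n x - b x))) \<longlonglongrightarrow> ennreal (norm (f x - b x))"
        by (intro tendsto_intros)
      then show ?case by (rule lim_imp_Liminf[symmetric, rotated]) simp
    qed
  qed
  have bound: "ennreal (norm (Bochner_Integration.simple_bochner_integral M (s n)
      - Bochner_Integration.simple_bochner_integral M (t n))) \<le> ?S n + ?T n" for n
  proof -
    note st = simple_bochner_integrable_compose2[of "(-)", OF _ s[of n] t[of n], simplified]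
    note nst = simple_bochner_integrable_compose2[of "\<lambda>a b. norm (a - b)", OF _ s[of n] t[of n], simplified]
    have sn: "simple_function M (s n)" and tn: "simple_function M (t n)"
      using s[of n] t[of n] by (auto elim: Bochner_Integration.simple_bochner_integrable.cases)
    obtain g h where [measurable]: "g \<in> borel_measurable M" "h \<in> borel_measurable M"
      and g: "AE x in M. ennreal (norm (f x - s n x)) = g x"
      and h: "AE x in M. ennreal (norm (f x - t n x)) = h x"
      using meas[OF sn] meas[OF tn] by blast
    have "ennreal (norm (Bochner_Integration.simple_bochner_integral M (s n)
        - Bochner_Integration.simple_bochner_integral M (t n)))
        = ennreal (norm (Bochner_Integration.simple_bochner_integral M (\<lambda>x. s n x - t n x)))"
      by (simp add: simple_bochner_integral_diff[OF s t])
    also have "\<dots> \<le> ennreal (Bochner_Integration.simple_bochner_integral M (\<lambda>x. norm (s n x - t n x)))"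
      by (intro ennreal_leI simple_bochner_integral_norm_bound st)
    also have "\<dots> = (\<integral>\<^sup>+ x. ennreal (norm (s n x - t n x)) \<partial>M)"
      by (rule simple_bochner_integral_eq_nn_integral[OF nst]) simp
    also have "\<dots> \<le> (\<integral>\<^sup>+ x. g x + h x \<partial>M)"
    proof (rule nn_integral_mono_AE)
      show "AE x in M. ennreal (norm (s n x - t n x)) \<le> g x + h x"
        using g h
      proof eventually_elim
        case (elim x)
        have "norm (s n x - t n x) \<le> norm (f x - s n x) + norm (f x - t n x)"
          by (metis norm_minus_commute norm_triangle_le_diff norm_triangle_sub dist_norm dist_triangle2 dist_commute)
        then show ?case
          unfolding elim[symmetric] by (simp flip: ennreal_plus)
      qed
    qed
    also have "\<dots> = (\<integral>\<^sup>+ x. g x \<partial>M) + (\<integral>\<^sup>+ x. h x \<partial>M)"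
      by (rule nn_integral_add) auto
    also have "\<dots> = ?S n + ?T n"
      using nn_integral_cong_AE[OF g] nn_integral_cong_AE[OF h] by simp
    finally show ?thesis .
  qed
  have "(\<lambda>n. ennreal (norm (Bochner_Integration.simple_bochner_integral M (s n)
      - Bochner_Integration.simple_bochner_integral M (t n)))) \<longlonglongrightarrow> ennreal (norm (I - I'))"
    by (intro tendsto_intros sI tI)
  moreover have "(\<lambda>n. ?S n + ?T n) \<longlonglongrightarrow> 0"
    using tendsto_add[OF s0 t0] by simp
  ultimately have "ennreal (norm (I - I')) \<le> 0"
    by (rule LIMSEQ_le) (use bound in auto)
  then show ?thesis by simp
qed

corollary Bochner_integral_eq:
  assumes "has_Bochner_integral M f I"
  shows "Bochner_integral M f = I"
  unfolding Bochner_integral_def using assms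
  by (auto intro: the_equality has_Bochner_integral_unique)


section \<open>Lebesgue--Bochner spaces\<close>

definition Lp_norm :: "real \<Rightarrow> (real \<Rightarrow> 'b::real_normed_vector) \<Rightarrow> ennreal" where
  "Lp_norm p f =
     (let I = \<integral>\<^sup>+ x. ennreal (norm (f x) powr p) \<partial>lebesgue
      in if I = \<infinity> then \<infinity> else ennreal (enn2real I powr (1 / p)))"

definition Lp_space :: "real \<Rightarrow> (real \<Rightarrow> 'b::real_normed_vector) set" where
  "Lp_space p = {f. strongly_measurable lebesgue f \<and> Lp_norm p f < \<infinity>}"


section \<open>Averages and their variation\<close>

definition avg :: "real \<Rightarrow> (real \<Rightarrow> 'b::real_normed_vector) \<Rightarrow> real \<Rightarrow> 'b" where
  "avg t f x = (1 / t) *\<^sub>R Bochner_integral lebesgue (\<lambda>y. indicator {-t..t} y *\<^sub>R f (x - y))"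

definition decreasing_seqs :: "real set \<Rightarrow> real list set" where
  "decreasing_seqs J = {ts. sorted_wrt (>) ts \<and> set ts \<subseteq> J}"

definition variation :: "real \<Rightarrow> real set \<Rightarrow> (real \<Rightarrow> linfty) \<Rightarrow> real \<Rightarrow> linfty" where
  "variation q J f x =
     Sup_fin ((\<lambda>ts. linfty_powr
                 (\<Sum>i<length ts - 1. linfty_powr \<bar>avg (ts ! i) f x - avg (ts ! Suc i) f x\<bar> q)
                 (1 / q)) ` decreasing_seqs J)"

text \<open>For finite \<open>J\<close> the supremum in \<open>variation\<close> is over a finite nonempty set, as
  \<^const>\<open>Sup_fin\<close> requires.\<close>

lemma decreasing_seqs_nonempty: "decreasing_seqs J \<noteq> {}"
  by (auto simp: decreasing_seqs_def intro!: exI[of _ "[]"])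

lemma finite_decreasing_seqs:
  assumes "finite J"
  shows "finite (decreasing_seqs J)"
proof (rule finite_subset)
  show "decreasing_seqs J \<subseteq> {ts. set ts \<subseteq> J \<and> distinct ts}"
    by (auto simp: decreasing_seqs_def distinct_conv_nth sorted_wrt_iff_nth_less)
       (metis less_irrefl linorder_neqE_nat)
  show "finite {ts. set ts \<subseteq> J \<and> distinct ts}"
    using finite_subset_distinct[OF assms] by (simp add: conj_commute)
qed

end

theory Submission
  imports Defs
begin

text \<open>In \<open>L\<^sup>\<infinity>\<close> one function may carry, for each position \<open>x\<close>, a separate scalar function
  oscillating at many scales around \<open>x\<close>. Let \<open>f\<close> be the step function whose value on the cell
  \<open>[i, i + 1)\<close> is, at points \<open>w\<close> of the cell \<open>[j, j + 1)\<close>, the indicator of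
  \<open>8\<^sup>k \<le> i - j < 8\<^sup>k\<^sup>+\<^sup>1\<close> for some even \<open>k\<close>. If \<open>x\<close> and \<open>w\<close> lie in the same cell, the average of
  \<open>f\<close> at scale \<open>8\<^sup>k\<^sup>+\<^sup>1\<close> is at least 7/8 for even \<open>k\<close> and at most 2/8 for odd \<open>k\<close>, so with \<open>N + 1\<close>
  scales the variation has norm at least \<open>N\<^sup>1\<^sup>/\<^sup>q / 2\<close> at every \<open>x \<in> [0, 8\<^sup>N\<^sup>+\<^sup>1)\<close>, while
  \<open>\<parallel>f x\<parallel> \<le> 1\<close> is supported on \<open>[0, 2 \<cdot> 8\<^sup>N\<^sup>+\<^sup>1)\<close>.\<close>

section \<open>Bochner integrals of step functions\<close>

lemma simple_bochner_integrable_indicator_scaleR: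
  fixes v :: "'b::real_normed_vector"
  assumes A: "A \<in> sets M" "emeasure M A < \<infinity>"
  shows "Bochner_Integration.simple_bochner_integrable M (\<lambda>x. indicator A x *\<^sub>R v)"
    and "Bochner_Integration.simple_bochner_integral M (\<lambda>x. indicator A x *\<^sub>R v) = measure M A *\<^sub>R v"
proof -
  have sf: "simple_function M (indicator A :: _ \<Rightarrow> real)"
    using A by (rule_tac simple_function_indicator)
  have sbi: "Bochner_Integration.simple_bochner_integrable M (indicator A :: _ \<Rightarrow> real)"
  proof
    have "{y \<in> space M. (indicator A y :: real) \<noteq> 0} = A"
      using sets.sets_into_space[OF A(1)] by (auto split: split_indicator)
    then show "emeasure M {y \<in> space M. (indicator A y :: real) \<noteq> 0} \<noteq> \<infinity>"
      using A by auto
  qed (rule sf)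
  show "Bochner_Integration.simple_bochner_integrable M (\<lambda>x. indicator A x *\<^sub>R v)"
    by (rule simple_bochner_integrable_compose2[OF _ sbi sbi, of "\<lambda>a b. a *\<^sub>R v"]) simp
  have "Bochner_Integration.simple_bochner_integral M (indicator A :: _ \<Rightarrow> real) = measure M A"
    using simple_bochner_integral_eq_nn_integral[OF sbi] A
    by (simp add: ennreal_indicator emeasure_eq_ennreal_measure)
  moreover have "linear (\<lambda>c::real. c *\<^sub>R v)"
    by (rule bounded_linear.linear[OF bounded_linear_scaleR_left])
  ultimately show
    "Bochner_Integration.simple_bochner_integral M (\<lambda>x. indicator A x *\<^sub>R v) = measure M A *\<^sub>R v"
    using simple_bochner_integral_linear[OF _ sbi, of "\<lambda>c. c *\<^sub>R v"] by simp
qed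

text \<open>Serves twice: for the strong measurability of \<open>wave_train\<close>, and for its
  averages, whose integrands are again step functions.\<close>

lemma simple_bochner_step_function:
  fixes v :: "'i \<Rightarrow> 'b::real_normed_vector"
  assumes "finite I" and "\<And>i. i \<in> I \<Longrightarrow> A i \<in> sets M" "\<And>i. i \<in> I \<Longrightarrow> emeasure M (A i) < \<infinity>"
  shows "Bochner_Integration.simple_bochner_integrable M (\<lambda>x. \<Sum>i\<in>I. indicator (A i) x *\<^sub>R v i) \<and>
    Bochner_Integration.simple_bochner_integral M (\<lambda>x. \<Sum>i\<in>I. indicator (A i) x *\<^sub>R v i)
      = (\<Sum>i\<in>I. measure M (A i) *\<^sub>R v i)"
  using assms
proof (induction I)
  case empty
  have "Bochner_Integration.simple_bochner_integrable M (\<lambda>x. 0 :: 'b)"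
    by (simp add: Bochner_Integration.simple_bochner_integrable.simps)
  moreover have "Bochner_Integration.simple_bochner_integral M (\<lambda>x. 0 :: 'b) = 0"
    unfolding Bochner_Integration.simple_bochner_integral_def by (intro sum.neutral) auto
  ultimately show ?case by simp
next
  case (insert i I)
  then have IH: "Bochner_Integration.simple_bochner_integrable M (\<lambda>x. \<Sum>i\<in>I. indicator (A i) x *\<^sub>R v i)"
    "Bochner_Integration.simple_bochner_integral M (\<lambda>x. \<Sum>i\<in>I. indicator (A i) x *\<^sub>R v i)
      = (\<Sum>i\<in>I. measure M (A i) *\<^sub>R v i)"
    by auto
  have i: "Bochner_Integration.simple_bochner_integrable M (\<lambda>x. indicator (A i) x *\<^sub>R v i)"
    "Bochner_Integration.simple_bochner_integral M (\<lambda>x. indicator (A i) x *\<^sub>R v i)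
      = measure M (A i) *\<^sub>R v i"
    using insert.prems by (auto intro!: simple_bochner_integrable_indicator_scaleR)
  show ?case
    unfolding sum.insert[OF insert.hyps]
    using simple_bochner_integrable_compose2[of "(+)", OF add_0_right i(1) IH(1)]
      simple_bochner_integral_add[OF i(1) IH(1)]
    unfolding i(2) IH(2) by (rule conjI)
qed

lemma has_Bochner_integral_simple:
  assumes "Bochner_Integration.simple_bochner_integrable M f"
  shows "has_Bochner_integral M f (Bochner_Integration.simple_bochner_integral M f)"
  unfolding has_Bochner_integral_def strongly_measurable_def
  using assms
  by (auto intro!: exI[of _ "\<lambda>_. f"] elim: Bochner_Integration.simple_bochner_integrable.cases)

lemma lmeasurable_half_open_ivl: "{a..<b::real} \<in> lmeasurable" "{a<..b::real} \<in> lmeasurable"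
  by (rule bounded_set_imp_lmeasurable; auto intro: bounded_subset[of "{a..b}"])+

section \<open>Bounds for the Lebesgue--Bochner norm\<close>

lemma Lp_norm_upper:
  assumes "A \<in> lmeasurable" "0 < p" and le: "\<And>x. norm (f x) \<le> indicator A x"
  shows "Lp_norm p f \<le> ennreal (measure lebesgue A powr (1 / p))"
proof -
  let ?I = "\<integral>\<^sup>+ x. ennreal (norm (f x) powr p) \<partial>lebesgue"
  have fin: "emeasure lebesgue A = ennreal (measure lebesgue A)"
    using assms(1) by (rule emeasure_eq_measure2)
  have "?I \<le> (\<integral>\<^sup>+ x. indicator A x \<partial>lebesgue)"
  proof (rule nn_integral_mono)
    fix x
    show "ennreal (norm (f x) powr p) \<le> indicator A x"
    proof (cases "x \<in> A")
      case True
      then have "norm (f x) powr p \<le> 1 powr p"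
        using le[of x] \<open>0 < p\<close> by (intro powr_mono2) auto
      then show ?thesis using True by simp
    next
      case False
      then have "norm (f x) = 0" using le[of x] by simp
      then show ?thesis by simp
    qed
  qed
  also have "\<dots> = ennreal (measure lebesgue A)"
    using assms(1) fin by (simp add: fmeasurableD)
  finally have I: "?I \<le> ennreal (measure lebesgue A)" .
  then have "?I \<noteq> \<infinity>" by (metis ennreal_neq_top infinity_ennreal_def top_unique)
  moreover have "enn2real ?I \<le> measure lebesgue A"
    using enn2real_mono[OF I] by simp
  ultimately show ?thesis
    using \<open>0 < p\<close> unfolding Lp_norm_def Let_def
    by (auto intro!: ennreal_leI powr_mono2)
qed

text \<open>The nonnegative integral is a supremum over simple functions, hence monotone for
  arbitrary integrands. This allows \<open>f\<close> to be the variation, whose measurability is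
  never established.\<close>

lemma Lp_norm_lower:
  assumes "A \<in> lmeasurable" "0 < p" "0 \<le> c" and le: "\<And>x. x \<in> A \<Longrightarrow> c \<le> norm (f x)"
  shows "ennreal (c * measure lebesgue A powr (1 / p)) \<le> Lp_norm p f"
proof -
  let ?I = "\<integral>\<^sup>+ x. ennreal (norm (f x) powr p) \<partial>lebesgue"
  have fin: "emeasure lebesgue A = ennreal (measure lebesgue A)"
    using assms(1) by (rule emeasure_eq_measure2)
  have "ennreal (c powr p * measure lebesgue A) = (\<integral>\<^sup>+ x. ennreal (c powr p) * indicator A x \<partial>lebesgue)"
    using assms(1) fin by (simp add: fmeasurableD nn_integral_cmult_indicator ennreal_mult)
  also have "\<dots> \<le> ?I"
    using le \<open>0 < p\<close> \<open>0 \<le> c\<close>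
    by (intro nn_integral_mono) (auto split: split_indicator intro!: ennreal_leI powr_mono2)
  finally have I: "ennreal (c powr p * measure lebesgue A) \<le> ?I" .
  show ?thesis
  proof (cases "?I = \<infinity>")
    case True
    then show ?thesis by (simp add: Lp_norm_def)
  next
    case False
    have "c powr p * measure lebesgue A \<le> enn2real ?I"
      using enn2real_mono[OF I] False by (simp add: less_top)
    then have "(c powr p * measure lebesgue A) powr (1 / p) \<le> enn2real ?I powr (1 / p)"
      using \<open>0 < p\<close> by (intro powr_mono2) auto
    then have "c * measure lebesgue A powr (1 / p) \<le> enn2real ?I powr (1 / p)"
      using \<open>0 < p\<close> \<open>0 \<le> c\<close> by (simp add: powr_mult powr_powr)
    then show ?thesis
      using False by (auto simp: Lp_norm_def Let_def intro: ennreal_leI)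
  qed
qed

section \<open>Elements of $L^\infty$ that are constant on a set\<close>

text \<open>A class in \<open>linfty\<close> has no value at a point. Agreement with a constant on a
  set replaces evaluation: it passes through sums, scalar multiples, absolute values and powers, and
  on a set of positive measure it bounds the norm from below.\<close>

lift_definition constant_ae_on :: "real set \<Rightarrow> linfty \<Rightarrow> real \<Rightarrow> bool" is
  "\<lambda>A u c. AE w in lebesgue. w \<in> A \<longrightarrow> u w = c"
proof -
  fix A u u'
  assume "linfty_rel u u'"
  then have "AE w in lebesgue. u w = u' w"
    by (simp add: linfty_rel_def)
  then have "AE w in lebesgue. (w \<in> A \<longrightarrow> u w = c) = (w \<in> A \<longrightarrow> u' w = c)" for c
    by eventually_elim simp
  then show "(\<lambda>c. AE w in lebesgue. w \<in> A \<longrightarrow> u w = c) = (\<lambda>c. AE w in lebesgue. w \<in> A \<longrightarrow> u' w = c)"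
    by (intro ext eventually_subst)
qed

lemma constant_ae_on_arith:
  assumes "constant_ae_on A u a"
  shows "constant_ae_on A (r *\<^sub>R u) (r * a)"
    and "constant_ae_on A \<bar>u\<bar> \<bar>a\<bar>"
  using assms by (transfer, auto elim: eventually_mono)+

lemma constant_ae_on_powr:
  assumes "constant_ae_on A u a" "0 < s"
  shows "constant_ae_on A (linfty_powr u s) (\<bar>a\<bar> powr s)"
  using assms by transfer (auto elim: eventually_mono)

lemma constant_ae_on_add:
  assumes "constant_ae_on A u a" "constant_ae_on A v b"
  shows "constant_ae_on A (u + v) (a + b)"
  using assms by transfer (auto elim: eventually_elim2)

lemma constant_ae_on_diff:
  assumes "constant_ae_on A u a" "constant_ae_on A v b"
  shows "constant_ae_on A (u - v) (a - b)"
  using assms by transfer (auto elim: eventually_elim2)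

lemma constant_ae_on_sum:
  assumes "\<And>i. i \<in> I \<Longrightarrow> constant_ae_on A (u i) (a i)"
  shows "constant_ae_on A (\<Sum>i\<in>I. u i) (\<Sum>i\<in>I. a i)"
proof -
  have 0: "constant_ae_on A 0 0" by transfer simp
  show ?thesis
    using assms by (induction I rule: infinite_finite_induct) (auto simp: 0 constant_ae_on_add)
qed

text \<open>Almost everywhere the absolute value of a representative is at most the norm, so a
  larger constant on \<open>A\<close> would make \<open>A\<close> a null set.\<close>

lemma constant_ae_on_norm_ge:
  assumes "constant_ae_on A u a" "A \<in> sets lebesgue" "emeasure lebesgue A \<noteq> 0"
  shows "\<bar>a\<bar> \<le> norm u"
  using assms(1)
proof (transfer fixing: A a)
  fix u assume "linfty_rel u u" and a: "AE w in lebesgue. w \<in> A \<longrightarrow> u w = a"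
  then have u: "ess_bounded u" by (simp add: linfty_rel_def)
  let ?N = "real_of_ereal (esssup lebesgue (\<lambda>w. ereal \<bar>u w\<bar>))"
  show "\<bar>a\<bar> \<le> ?N"
  proof (rule ccontr)
    assume "\<not> \<bar>a\<bar> \<le> ?N"
    with a norm_linfty_rep(1)[OF u] have "AE w in lebesgue. w \<notin> A"
      by (auto elim: eventually_elim2)
    then have "A \<in> null_sets lebesgue"
      using assms(2) by (subst AE_iff_null_sets) auto
    then show False using assms(3) by auto
  qed
qed

lemma linfty_powr_nonneg: "0 \<le> linfty_powr u r"
  by transfer auto

section \<open>The oscillating function\<close>

text \<open>Truncated subtraction is harmless in \<open>i - j\<close>: zero lies in no annulus, so \<open>wave i\<close> vanishes
  on the cells to the right of \<open>i\<close>.\<close>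

definition in_even_annulus :: "nat \<Rightarrow> bool" where
  "in_even_annulus d \<longleftrightarrow> (\<exists>k. even k \<and> 8 ^ k \<le> d \<and> d < 8 ^ Suc k)"

text \<open>Annuli with distinct exponents are disjoint, so the parity of the exponent is determined
  by \<open>d\<close>.\<close>

lemma not_in_even_annulus:
  assumes "odd k" "8 ^ k \<le> d" "d < 8 ^ Suc k"
  shows "\<not> in_even_annulus d"
proof
  assume "in_even_annulus d"
  then obtain l where l: "even l" "8 ^ l \<le> d" "d < 8 ^ Suc l"
    by (auto simp: in_even_annulus_def)
  have "(8::nat) ^ l < 8 ^ Suc k" "(8::nat) ^ k < 8 ^ Suc l"
    using assms l by linarith+
  then have "l < Suc k" "k < Suc l"
    by (auto intro: power_less_imp_less_exp[of "8::nat"] simp del: power_Suc)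
  then have "l = k" by simp
  then show False using assms(1) l(1) by simp
qed

lemma ess_bounded_wave:
  "ess_bounded (indicator {w. in_even_annulus (i - nat \<lfloor>w\<rfloor>)})"
proof -
  have "(\<lambda>w::real. nat \<lfloor>w\<rfloor>) \<in> measurable borel (count_space UNIV)"
    by measurable
  then have "(\<lambda>w::real. in_even_annulus (i - nat \<lfloor>w\<rfloor>)) \<in> measurable borel (count_space UNIV)"
    by (rule measurable_compose) simp
  from predE[OF this] have "{w::real. in_even_annulus (i - nat \<lfloor>w\<rfloor>)} \<in> sets borel"
    by simp
  then have "{w::real. in_even_annulus (i - nat \<lfloor>w\<rfloor>)} \<in> sets lebesgue"
    by (simp add: sets_completionI_sets)
  then have "indicat_real {w::real. in_even_annulus (i - nat \<lfloor>w\<rfloor>)} \<in> borel_measurable lebesgue"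
    by (rule borel_measurable_indicator)
  moreover have "AE w in lebesgue. \<bar>indicat_real {w::real. in_even_annulus (i - nat \<lfloor>w\<rfloor>)} w\<bar> \<le> 1"
    by (rule AE_I2) (simp split: split_indicator)
  ultimately show ?thesis
    unfolding ess_bounded_def by (intro conjI exI[of _ 1])
qed

text \<open>For negative \<open>w\<close> the term \<open>nat \<lfloor>w\<rfloor>\<close> is 0, so
  the negative half-line repeats the value on \<open>cell 0\<close>. Only the bound by 1 matters
  there.\<close>

lift_definition wave :: "nat \<Rightarrow> linfty" is
  "\<lambda>i. indicator {w. in_even_annulus (i - nat \<lfloor>w\<rfloor>)}"
  by (simp add: linfty_rel_def ess_bounded_wave)

lemma norm_wave: "norm (wave i) \<le> 1"
  by transfer (rule norm_linfty_rep(2)[OF ess_bounded_wave], auto split: split_indicator)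

abbreviation cell :: "nat \<Rightarrow> real set" where
  "cell j \<equiv> {real j..<real j + 1}"

lemma constant_ae_on_wave: "constant_ae_on (cell j) (wave i) (of_bool (in_even_annulus (i - j)))"
proof transfer
  fix i j
  have "nat \<lfloor>w\<rfloor> = j" if "w \<in> cell j" for w
    using that by (auto simp: nat_eq_iff floor_eq_iff)
  then show "AE w in lebesgue. w \<in> cell j \<longrightarrow>
      indicator {w. in_even_annulus (i - nat \<lfloor>w\<rfloor>)} w = (of_bool (in_even_annulus (i - j)) :: real)"
    by (auto simp: indicator_def)
qed

definition wave_train :: "nat \<Rightarrow> real \<Rightarrow> linfty" where
  "wave_train n x = (\<Sum>i<n. indicator (cell i) x *\<^sub>R wave i)"

text \<open>The cells are disjoint: on the new \<open>cell n\<close> the induction hypothesis forces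
  the earlier sum to vanish, and off it the new summand vanishes.\<close>

lemma norm_wave_train: "norm (wave_train n x) \<le> indicator {0..<real n} x"
proof (induction n)
  case 0
  then show ?case by (simp add: wave_train_def)
next
  case (Suc n)
  show ?case
  proof (cases "x \<in> cell n")
    case True
    then have "wave_train n x = 0"
      using Suc by auto
    then show ?thesis
      using True norm_wave[of n] by (simp add: wave_train_def)
  next
    case False
    then show ?thesis
      using Suc by (auto simp: wave_train_def split: split_indicator_asm split_indicator)
  qed
qed

lemma wave_train_in_Lp:
  assumes "0 < p"
  shows "wave_train n \<in> Lp_space p" and "Lp_norm p (wave_train n) \<le> ennreal (real n powr (1 / p))"
proof -
  show n: "Lp_norm p (wave_train n) \<le> ennreal (real n powr (1 / p))"
    using Lp_norm_upper[of "{0..<real n}" p "wave_train n"] norm_wave_train assms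
    by (simp add: lmeasurable_half_open_ivl)
  have "Bochner_Integration.simple_bochner_integrable lebesgue (wave_train n)"
    using simple_bochner_step_function[of "{..<n}" cell lebesgue wave]
    unfolding wave_train_def[abs_def] by simp
  then have "strongly_measurable lebesgue (wave_train n)"
    using has_Bochner_integral_simple unfolding has_Bochner_integral_def by blast
  then show "wave_train n \<in> Lp_space p"
    using n by (auto simp: Lp_space_def intro: le_less_trans)
qed

section \<open>Averages of the step function at the powers of 8\<close>

definition overlap :: "real \<Rightarrow> real \<Rightarrow> nat \<Rightarrow> real" where
  "overlap t x i = measure lebesgue ({-t..t} \<inter> {x - real i - 1<..x - real i})"

lemma avg_wave_train:
  "avg t (wave_train n) x = (1 / t) *\<^sub>R (\<Sum>i<n. overlap t x i *\<^sub>R wave i)"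
proof -
  \<comment> \<open>\<open>?A i\<close> consists of the \<open>y\<close> in the window with
    \<open>x - y\<close> in \<open>cell i\<close>; the reflection exchanges the closed and the open
    end.\<close>
  let ?A = "\<lambda>i. {-t..t} \<inter> {x - real i - 1<..x - real i}"
  have "(\<lambda>y. indicator {-t..t} y *\<^sub>R wave_train n (x - y)) = (\<lambda>y. \<Sum>i<n. indicator (?A i) y *\<^sub>R wave i)"
    by (auto simp: wave_train_def scaleR_sum_right indicator_def fun_eq_iff intro!: sum.cong)
  moreover have "emeasure lebesgue (?A i) < \<infinity>" for i
    by (rule le_less_trans[OF emeasure_mono[of _ "{-t..t}"]]) (auto simp: emeasure_lborel_Icc_eq)
  ultimately show ?thesis
    using simple_bochner_step_function[of "{..<n}" ?A lebesgue wave]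
    by (simp add: avg_def overlap_def Bochner_integral_eq[OF has_Bochner_integral_simple])
qed

lemma overlap_bounds: "0 \<le> overlap t x i" "overlap t x i \<le> 1"
proof -
  show "0 \<le> overlap t x i" by (simp add: overlap_def)
  have "overlap t x i \<le> measure lebesgue {x - real i - 1<..x - real i}"
    unfolding overlap_def by (rule measure_mono_fmeasurable) (auto simp: lmeasurable_half_open_ivl)
  then show "overlap t x i \<le> 1" by simp
qed

lemma overlap_eq_1:
  assumes "x - t \<le> real i" "real i + 1 \<le> x + t"
  shows "overlap t x i = 1"
proof -
  have "{-t..t} \<inter> {x - real i - 1<..x - real i} = {x - real i - 1<..x - real i}"
    using assms by auto
  then show ?thesis by (simp add: overlap_def)
qed

lemma overlap_eq_0:
  assumes "x + t < real i"
  shows "overlap t x i = 0"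
proof -
  have "{-t..t} \<inter> {x - real i - 1<..x - real i} = {}"
    using assms by auto
  then show ?thesis by (simp add: overlap_def)
qed

text \<open>The scalar that the average at \<open>x\<close> equals on \<open>cell j\<close>. The
  window has length \<open>2 * t\<close> but the factor is \<open>1 / t\<close>; since cells with
  \<open>i \<le> j\<close> contribute 0, values near 1 come from the right half of the
  window.\<close>

definition cell_avg :: "nat \<Rightarrow> real \<Rightarrow> nat \<Rightarrow> real \<Rightarrow> real" where
  "cell_avg n x j t = (1 / t) * (\<Sum>i<n. overlap t x i * of_bool (in_even_annulus (i - j)))"

lemma constant_ae_on_avg:
  "constant_ae_on (cell j) (avg t (wave_train n) x) (cell_avg n x j t)"
  unfolding avg_wave_train cell_avg_def
  by (intro constant_ae_on_arith(1) constant_ae_on_sum constant_ae_on_wave)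

text \<open>The annulus of exponent \<open>k\<close> to the right of \<open>j\<close> consists of
  \<open>7 * 8 ^ k\<close> cells. All lie inside the window and carry the value 1, and the remaining
  terms are nonnegative.\<close>

lemma cell_avg_even_ge:
  assumes "x \<in> cell j" "even k" "j + 8 ^ Suc k \<le> n"
  shows "7 / 8 \<le> cell_avg n x j (8 ^ Suc k)"
proof -
  let ?t = "8 ^ Suc k :: real" and ?I = "{j + 8 ^ k..<j + 8 ^ Suc k}"
  have "real (card ?I) = (\<Sum>i\<in>?I. 1)" by simp
  also have "\<dots> = (\<Sum>i\<in>?I. overlap ?t x i * of_bool (in_even_annulus (i - j)))"
  proof (rule sum.cong)
    fix i assume i: "i \<in> ?I"
    have "in_even_annulus (i - j)"
      unfolding in_even_annulus_def using i \<open>even k\<close> by (intro exI[of _ k]) auto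
    moreover have "overlap ?t x i = 1"
    proof (rule overlap_eq_1)
      have "real (i + 1) \<le> real (j + 8 ^ Suc k)"
        using i by (intro of_nat_mono) auto
      then show "real i + 1 \<le> x + ?t" using assms(1) by simp
      have "real j \<le> real i" using i by (intro of_nat_mono) auto
      moreover have "1 \<le> ?t" by (rule one_le_power) simp
      ultimately show "x - ?t \<le> real i" using assms(1) by auto
    qed
    ultimately show "1 = overlap ?t x i * of_bool (in_even_annulus (i - j))" by simp
  qed simp
  also have "\<dots> \<le> (\<Sum>i<n. overlap ?t x i * of_bool (in_even_annulus (i - j)))"
    using assms(3) by (intro sum_mono2) (auto simp: overlap_bounds)
  finally have "7 * 8 ^ k \<le> (\<Sum>i<n. overlap ?t x i * of_bool (in_even_annulus (i - j)))"
    by simp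
  then show ?thesis
    by (simp add: cell_avg_def field_simps)
qed

text \<open>The annulus of exponent \<open>k\<close> carries 0, so at most the \<open>8 ^ k\<close>
  cells before it and one cell at the right edge contribute. Together these are at most
  \<open>2 * 8 ^ k\<close> cells.\<close>

lemma cell_avg_odd_le:
  assumes "x \<in> cell j" "odd k"
  shows "cell_avg n x j (8 ^ Suc k) \<le> 2 / 8"
proof -
  \<comment> \<open>The inserted cell is the one that the window enters when \<open>x\<close> lies
    strictly to the right of \<open>j\<close>.\<close>
  let ?t = "8 ^ Suc k :: real" and ?I = "insert (j + 8 ^ Suc k) {j..<j + 8 ^ k}"
  have "overlap ?t x i * of_bool (in_even_annulus (i - j)) \<le> of_bool (i \<in> ?I)" for i
  proof (cases "i \<in> ?I \<or> \<not> in_even_annulus (i - j)")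
    case True
    then show ?thesis using overlap_bounds[of ?t x i] by auto
  next
    case False
    then have *: "i \<notin> ?I" "in_even_annulus (i - j)" by auto
    \<comment> \<open>Truncated subtraction sends every \<open>i \<le> j\<close> to 0, which lies in
      no annulus; so \<open>i\<close> lies to the right of \<open>j\<close>.\<close>
    have "0 < i - j"
      using *(2) by (auto simp: in_even_annulus_def intro: less_le_trans[rotated])
    then have "8 ^ k \<le> i - j" using *(1) by auto
    then have "8 ^ Suc k \<le> i - j"
      using *(2) not_in_even_annulus[OF \<open>odd k\<close>, of "i - j"] by linarith
    then have "j + 8 ^ Suc k + 1 \<le> i" using *(1) by auto
    then have "real (j + 8 ^ Suc k + 1) \<le> real i" by (intro of_nat_mono)
    then have "overlap ?t x i = 0"
      using assms(1) by (intro overlap_eq_0) simp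
    then show ?thesis by simp
  qed
  then have "(\<Sum>i<n. overlap ?t x i * of_bool (in_even_annulus (i - j))) \<le> (\<Sum>i<n. of_bool (i \<in> ?I))"
    by (rule sum_mono)
  also have "\<dots> = real (card ({..<n} \<inter> ?I))"
    by (simp add: of_bool_def sum.If_cases del: insert_iff)
  also have "\<dots> \<le> real (card ?I)"
    by (intro of_nat_mono card_mono) auto
  also have "\<dots> \<le> 2 * 8 ^ k"
    using one_le_power[of "8::real" k] by (subst card.insert) auto
  finally show ?thesis
    by (simp add: cell_avg_def field_simps)
qed

text \<open>Consecutive exponents have opposite parity, and \<open>7 / 8 - 2 / 8\<close> exceeds
  \<open>1 / 2\<close>.\<close>

lemma cell_avg_jump:
  assumes "x \<in> cell j" "j + 8 ^ Suc (Suc k) \<le> n"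
  shows "1 / 2 \<le> \<bar>cell_avg n x j (8 ^ Suc (Suc k)) - cell_avg n x j (8 ^ Suc k)\<bar>"
proof (cases "even k")
  case True
  have "j + 8 ^ Suc k \<le> n" using assms(2) by simp
  from cell_avg_even_ge[OF assms(1) True this]
  have "7 / 8 \<le> cell_avg n x j (8 ^ Suc k)" .
  moreover have "cell_avg n x j (8 ^ Suc (Suc k)) \<le> 2 / 8"
    by (rule cell_avg_odd_le[OF assms(1)]) (use True in simp)
  ultimately show ?thesis by linarith
next
  case False
  have "7 / 8 \<le> cell_avg n x j (8 ^ Suc (Suc k))"
    by (rule cell_avg_even_ge[OF assms(1) _ assms(2)]) (use False in simp)
  moreover have "cell_avg n x j (8 ^ Suc k) \<le> 2 / 8"
    by (rule cell_avg_odd_le[OF assms(1) False])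
  ultimately show ?thesis by linarith
qed

section \<open>Lower bound for the variation and failure of uniform boundedness\<close>

lemma norm_variation_ge:
  fixes q :: real
  assumes "0 < q" and x: "0 \<le> x" "x < 8 ^ Suc N"
  shows "real N powr (1 / q) / 2 \<le> norm (variation q ((\<lambda>i. 8 ^ i) ` {..Suc N}) (wave_train (2 * 8 ^ Suc N)) x)"
proof -
  \<comment> \<open>Twice the largest scale: for every \<open>j < 8 ^ Suc N\<close> the cells up to
    \<open>j + 8 ^ Suc N\<close> still fit into the train.\<close>
  define n :: nat where "n = 2 * 8 ^ Suc N"
  \<comment> \<open>The part of the coordinate space that is tested moves with \<open>x\<close>. The
    supremum norm allows a different choice at each \<open>x\<close> without enlarging the norm of
    the function.\<close>
  define j where "j = nat \<lfloor>x\<rfloor>"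
  let ?J = "(\<lambda>i. 8 ^ i) ` {..Suc N} :: real set"
  define T where "T ts = linfty_powr (\<Sum>i<length ts - 1.
      linfty_powr \<bar>avg (ts ! i) (wave_train n) x - avg (ts ! Suc i) (wave_train n) x\<bar> q) (1 / q)" for ts
  \<comment> \<open>The exponents run from \<open>Suc N\<close> down to 1, giving \<open>N\<close>
    jumps. Exponent 0 is left out because the bounds on averages concern scales
    \<open>8 ^ Suc k\<close>.\<close>
  define ts :: "real list" where "ts = map (\<lambda>i. 8 ^ (Suc N - i)) [0..<Suc N]"
  have xj: "x \<in> cell j"
    using x(1) unfolding j_def by (auto simp: of_nat_nat)
  have "real j < real (8 ^ Suc N)" using xj x(2) by simp
  then have j: "j < 8 ^ Suc N" by (simp only: of_nat_less_iff)
  have ts: "ts \<in> decreasing_seqs ?J"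
    by (auto simp: decreasing_seqs_def ts_def sorted_wrt_iff_nth_less simp del: upt_Suc power_Suc
        intro!: power_strict_increasing)
  have len: "length ts - 1 = N" by (simp add: ts_def)
  let ?d = "\<lambda>i. \<bar>cell_avg n x j (ts ! i) - cell_avg n x j (ts ! Suc i)\<bar>"
  \<comment> \<open>The nested absolute values arise because \<open>linfty_powr\<close> takes the
    absolute value of its argument.\<close>
  have const: "constant_ae_on (cell j) (T ts) (\<bar>\<Sum>i<N. \<bar>?d i\<bar> powr q\<bar> powr (1 / q))"
    unfolding T_def len using \<open>0 < q\<close>
    by (intro constant_ae_on_arith(2) constant_ae_on_powr constant_ae_on_sum constant_ae_on_diff constant_ae_on_avg) auto
  have jump: "(1 / 2) powr q \<le> \<bar>?d i\<bar> powr q" if "i < N" for i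
  proof -
    have "Suc N - i = Suc (Suc (N - Suc i))" "Suc N - Suc i = Suc (N - Suc i)"
      using that by auto
    then have tsi: "ts ! i = 8 ^ Suc (Suc (N - Suc i))" "ts ! Suc i = 8 ^ Suc (N - Suc i)"
      using that unfolding ts_def by (simp_all del: upt_Suc power_Suc)
    have "(8::nat) ^ Suc (Suc (N - Suc i)) \<le> 8 ^ Suc N"
      using that by (intro power_increasing) auto
    then have "j + 8 ^ Suc (Suc (N - Suc i)) \<le> n"
      using j unfolding n_def by linarith
    from cell_avg_jump[OF xj this] show ?thesis
      unfolding tsi using \<open>0 < q\<close> by (intro powr_mono2) auto
  qed
  have "real N powr (1 / q) / 2 = (real N * (1 / 2) powr q) powr (1 / q)"
    using \<open>0 < q\<close> by (simp add: powr_mult powr_powr)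
  also have "\<dots> \<le> (\<Sum>i<N. \<bar>?d i\<bar> powr q) powr (1 / q)"
    using \<open>0 < q\<close> sum_mono[of "{..<N}" "\<lambda>i. (1 / 2) powr q" "\<lambda>i. \<bar>?d i\<bar> powr q"] jump
    by (intro powr_mono2) auto
  also have "\<dots> = \<bar>\<bar>\<Sum>i<N. \<bar>?d i\<bar> powr q\<bar> powr (1 / q)\<bar>"
    by (simp add: sum_nonneg)
  also have "\<dots> \<le> norm (T ts)"
    by (rule constant_ae_on_norm_ge[OF const]) auto
  also have "\<dots> \<le> norm (variation q ?J (wave_train n) x)"
  proof (rule norm_linfty_mono)
    have "T ts \<le> variation q ?J (wave_train n) x"
      unfolding variation_def T_def[symmetric]
      by (rule Sup_fin.coboundedI) (use ts finite_decreasing_seqs[of ?J] in auto)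
    moreover have "0 \<le> T ts" unfolding T_def by (rule linfty_powr_nonneg)
    ultimately show "\<bar>T ts\<bar> \<le> \<bar>variation q ?J (wave_train n) x\<bar>"
      by (metis abs_of_nonneg order_trans)
  qed
  finally show ?thesis unfolding n_def .
qed

text \<open>With \<open>M = 8 ^ Suc N\<close>, the variation is at least
  \<open>N powr (1 / q) / 2\<close> on a set of measure \<open>M\<close>, while the function is
  bounded by 1 and supported on a set of measure \<open>2 * M\<close>. The powers of
  \<open>M\<close> cancel and the growth in \<open>N\<close> remains.\<close>

theorem theorem1p1:
  fixes p q :: real
  assumes "2 < q" and "1 < p"
  shows "\<not> (\<exists>K::real. \<forall>J f. finite J \<longrightarrow> J \<subseteq> {0<..} \<longrightarrow> f \<in> Lp_space p \<longrightarrow>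
            Lp_norm p (variation q J f) \<le> ennreal K * Lp_norm p f)"
proof
  assume "\<exists>K::real. \<forall>J f. finite J \<longrightarrow> J \<subseteq> {0<..} \<longrightarrow> f \<in> Lp_space p \<longrightarrow>
            Lp_norm p (variation q J f) \<le> ennreal K * Lp_norm p f"
  then obtain K0 :: real where K0: "\<And>J f. finite J \<Longrightarrow> J \<subseteq> {0<..} \<Longrightarrow> f \<in> Lp_space p \<Longrightarrow>
            Lp_norm p (variation q J f) \<le> ennreal K0 * Lp_norm p f"
    by blast
  \<comment> \<open>\<open>ennreal\<close> sends negative reals to 0; a nonnegative constant lets
    the product be read back in the reals.\<close>
  define K where "K = max K0 0"
  have pq: "0 < p" "0 < q" using assms by auto
  have bound: "real N powr (1 / q) / 2 \<le> K * 2 powr (1 / p)" for N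
  proof -
    let ?M = "8 ^ Suc N :: real" and ?J = "(\<lambda>i. 8 ^ i) ` {..Suc N} :: real set"
      and ?f = "wave_train (2 * 8 ^ Suc N)"
    have n: "real (2 * 8 ^ Suc N) = 2 * ?M" by simp
    have "ennreal (real N powr (1 / q) / 2 * ?M powr (1 / p)) \<le> Lp_norm p (variation q ?J ?f)"
      using Lp_norm_lower[of "{0..<?M}" p "real N powr (1 / q) / 2" "variation q ?J ?f"]
        norm_variation_ge[OF pq(2), of _ N] pq(1)
      by (simp add: lmeasurable_half_open_ivl)
    also have "\<dots> \<le> ennreal K0 * Lp_norm p ?f"
      using pq(1) by (intro K0 wave_train_in_Lp) auto
    also have "\<dots> \<le> ennreal K * ennreal ((2 * ?M) powr (1 / p))"
      using wave_train_in_Lp(2)[OF pq(1), of "2 * 8 ^ Suc N"] unfolding n K_def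
      by (intro mult_mono ennreal_leI) auto
    finally have "real N powr (1 / q) / 2 * ?M powr (1 / p) \<le> K * (2 * ?M) powr (1 / p)"
      by (simp add: ennreal_mult[symmetric] K_def del: power_Suc)
    then have "real N powr (1 / q) / 2 * ?M powr (1 / p) \<le> (K * 2 powr (1 / p)) * ?M powr (1 / p)"
      by (simp add: powr_mult mult.assoc del: power_Suc)
    moreover have "0 < ?M powr (1 / p)" by simp
    ultimately show ?thesis by (simp only: mult_le_cancel_right_pos)
  qed
  define L where "L = 2 * (K * 2 powr (1 / p))"
  have L: "0 \<le> L" by (simp add: L_def K_def)
  \<comment> \<open>This choice makes \<open>N powr (1 / q)\<close> exceed \<open>L\<close>, whereas
    \<open>bound\<close> keeps it at most \<open>L\<close> for every \<open>N\<close>.\<close>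
  obtain N :: nat where N: "L powr q < real N"
    using reals_Archimedean2 by blast
  have "L = (L powr q) powr (1 / q)" using pq L by (simp add: powr_powr)
  also have "\<dots> < real N powr (1 / q)"
    using N pq by (intro powr_less_mono2) auto
  also have "\<dots> \<le> L" using bound[of N] by (simp add: L_def)
  finally show False by simp
qed

end
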